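(* The sets of patterns $\{112,1231\}$ and $\{121,1132\}$ are $m$-equivalent, that is, $\{112,1231\}\sim\{121,1132\}$.
   Context: A (finite, reduced) multiset is $S=1^{a_1}2^{a_2}\cdots k^{a_k}$ with $k\ge 1$ and all $a_i\ge 1$, meaning that $i$ occurs with multiplicity $a_i$. A multipermutation of $S$ is a word having exactly $a_i$ occurrences of each letter $i\in[k]=\{1,\dots,k\}$ and no other letters. A word $\pi=\pi_1\cdots\pi_n$ contains a pattern (word) $\rho=\rho_1\cdots\rho_\ell$ if there are indices $i(1)<\cdots<i(\ell)$ such that for all $a,b\in[\ell]$: $\pi_{i(a)}<\pi_{i(b)}$ iff $\rho_a<\rho_b$, and $\pi_{i(a)}>\pi_{i(b)}$ iff $\rho_a>\rho_b$; otherwise $\pi$ avoids $\rho$. For a set $P$ of patterns, $\mathrm{av}(S;P)$ is the number of multipermutations of $S$ that avoid every pattern in $P$. Two sets of patterns $P,Q$ are $m$-equivalent, written here $P\sim Q$, if $\mathrm{av}(S;P)=\mathrm{av}(S;Q)$ for every multiset $S$. *)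

theory Defs
  imports "HOL-Combinatorics.Multiset_Permutations"
begin

text \<open>Finite reduced multisets \<open>1^(a_1) ... k^(a_k)\<close> with \<open>k \<ge> 1\<close> and all \<open>a_i \<ge> 1\<close>;
  the multiplicity \<open>a_i\<close> is \<open>count S i\<close>.\<close>

definition reduced_multiset :: "nat multiset \<Rightarrow> bool" where
  "reduced_multiset S \<longleftrightarrow> (\<exists>k\<ge>1. set_mset S = {1..k})"

text \<open>Positions in words are numbered from \<open>0\<close>, as usual for lists; \<open>i\<close> selects the subsequence.\<close>

definition contains_pattern :: "nat list \<Rightarrow> nat list \<Rightarrow> bool" where
  "contains_pattern \<pi> \<rho> \<longleftrightarrow>
     (\<exists>i :: nat \<Rightarrow> nat.
        strict_mono_on {..<length \<rho>} i \<and>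
        (\<forall>a<length \<rho>. i a < length \<pi>) \<and>
        (\<forall>a<length \<rho>. \<forall>b<length \<rho>.
           (\<pi> ! i a < \<pi> ! i b \<longleftrightarrow> \<rho> ! a < \<rho> ! b) \<and>
           (\<pi> ! i a > \<pi> ! i b \<longleftrightarrow> \<rho> ! a > \<rho> ! b)))"

abbreviation avoids_pattern :: "nat list \<Rightarrow> nat list \<Rightarrow> bool" where
  "avoids_pattern \<pi> \<rho> \<equiv> \<not> contains_pattern \<pi> \<rho>"

text \<open>The multipermutations of \<open>S\<close> are the elements of \<open>permutations_of_multiset S\<close>, a finite set.\<close>

definition av :: "nat multiset \<Rightarrow> nat list set \<Rightarrow> nat" where
  "av S P = card {\<pi> \<in> permutations_of_multiset S. \<forall>\<rho>\<in>P. avoids_pattern \<pi> \<rho>}"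

definition m_equivalent :: "nat list set \<Rightarrow> nat list set \<Rightarrow> bool" (infix \<open>\<sim>\<^sub>m\<close> 50) where
  "P \<sim>\<^sub>m Q \<longleftrightarrow> (\<forall>S. reduced_multiset S \<longrightarrow> av S P = av S Q)"

end

theory Submission
  imports Defs "HOL-Library.Sublist"
begin

text \<open>Remove all copies of the smallest letter \<open>m\<close>, of multiplicity \<open>a\<close>. The remaining word is again
  avoiding, and the ways of putting \<open>m\<close> back depend only on its length and on the length \<open>d\<close> of its
  longest weakly decreasing (for the first set of patterns) or weakly increasing (for the second)
  suffix: if \<open>a = 1\<close> every position is allowed; if \<open>a \<ge> 2\<close> the word must take the form
  \<open>u m v m\<^sup>a\<^sup>-\<^sup>1\<close>, respectively \<open>u m\<^sup>a v\<close>, with \<open>v\<close> contained in that suffix. The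
  multisets of values of \<open>d\<close> after the insertion are the same in both cases, so a bijection between
  the two classes that matches the two suffix statistics is built by recursion. All words are
  reversed below, which turns suffixes into prefixes.\<close>

section \<open>Subsequences\<close>

lemma subseq_rev: "subseq xs ys \<Longrightarrow> subseq (rev xs) (rev ys)"
  by (induction rule: list_emb.induct) (auto intro: list_emb_append_mono subseq_rev_drop_many)

lemma subseq_rev_iff: "subseq (rev xs) (rev ys) \<longleftrightarrow> subseq xs ys"
  using subseq_rev[of xs ys] subseq_rev[of "rev xs" "rev ys"] by auto

lemma subseq_count_list_le: "subseq xs ys \<Longrightarrow> count_list xs x \<le> count_list ys x"
  by (induction rule: list_emb.induct) auto

lemma subseq_set: "subseq xs ys \<Longrightarrow> set xs \<subseteq> set ys"
  by (induction rule: list_emb.induct) auto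

lemma subseq_filter_iff:
  assumes "\<forall>x\<in>set xs. P x"
  shows "subseq xs (filter P ys) \<longleftrightarrow> subseq xs ys"
proof
  assume "subseq xs ys"
  then have "subseq (filter P xs) (filter P ys)" by simp
  then show "subseq xs (filter P ys)" using assms by (simp add: filter_id_conv)
qed (meson subseq_filter_left subseq_order.trans)

lemma subseq_Cons_append_notin:
  "y \<notin> set us \<Longrightarrow> subseq (y # xs) (us @ vs) \<longleftrightarrow> subseq (y # xs) vs"
  by (induction us) auto

lemma subseq_snoc_append_notin:
  assumes "y \<notin> set vs"
  shows "subseq (xs @ [y]) (us @ vs) \<longleftrightarrow> subseq (xs @ [y]) us"
proof -
  have "subseq (rev (xs @ [y])) (rev (us @ vs)) \<longleftrightarrow> subseq (rev (xs @ [y])) (rev us)"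
    using assms by (simp add: subseq_Cons_append_notin)
  then show ?thesis by (simp only: subseq_rev_iff)
qed

lemma subseq_snoc_append_Cons:
  assumes "y \<notin> set vs"
  shows "subseq (xs @ [y]) (us @ y # vs) \<longleftrightarrow> subseq xs us"
  using subseq_snoc_append_notin[OF assms, of xs "us @ [y]"] by simp

text \<open>The bridge from avoidance to runs: once the outer copies of the smallest letter are
  matched, a forbidden pattern leaves a two-letter subsequence, whose absence is sortedness.\<close>

lemma sorted_wrt_iff_subseq: "sorted_wrt R xs \<longleftrightarrow> (\<forall>x y. subseq [x, y] xs \<longrightarrow> R x y)"
proof (induction xs)
  case (Cons a xs)
  have "(\<forall>x y. subseq [x, y] (a # xs) \<longrightarrow> R x y) \<longleftrightarrow>
      (\<forall>y\<in>set xs. R a y) \<and> (\<forall>x y. subseq [x, y] xs \<longrightarrow> R x y)"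
  proof safe
    fix x y assume "\<forall>y\<in>set xs. R a y" "\<forall>x y. subseq [x, y] xs \<longrightarrow> R x y" "subseq [x, y] (a # xs)"
    then show "R x y" by (cases "x = a") (auto simp: subseq_singleton_left)
  next
    fix x y assume "\<forall>x y. subseq [x, y] (a # xs) \<longrightarrow> R x y" "subseq [x, y] xs"
    then show "R x y" using list_emb_Cons by blast
  qed (auto simp: subseq_singleton_left)
  then show ?case using Cons by simp
qed simp

section \<open>Pattern occurrences as order-isomorphic subsequences\<close>

lemma subseq_map_nth:
  assumes "strict_mono_on {..<n} i" "\<forall>a<n. i a < length xs"
  shows "subseq (map (\<lambda>a. xs ! i a) [0..<n]) xs"
  using assms
proof (induction n arbitrary: xs)
  case (Suc n)
  let ?ys = "take (i n) xs"
  \<comment> \<open>Strict monotonicity puts all earlier indices below \<open>i n\<close>, so the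
    induction hypothesis applies to the prefix before that position.\<close>
  have lt: "i a < i n" if "a < n" for a
    using strict_mono_onD[OF Suc.prems(1), of a n] that by auto
  have "strict_mono_on {..<n} i"
    using Suc.prems(1) by (rule monotone_on_subset) auto
  then have "subseq (map (\<lambda>a. ?ys ! i a) [0..<n]) ?ys"
    using lt Suc.prems(2) by (intro Suc.IH) auto
  moreover have "map (\<lambda>a. ?ys ! i a) [0..<n] = map (\<lambda>a. xs ! i a) [0..<n]"
    using lt by auto
  ultimately have "subseq (map (\<lambda>a. xs ! i a) [0..<n] @ [xs ! i n]) (?ys @ xs ! i n # drop (Suc (i n)) xs)"
    by (intro list_emb_append_mono) auto
  then show ?case using Suc.prems(2) by (simp add: id_take_nth_drop[symmetric])
qed simp

lemma subseq_obtain_indices: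
  assumes "subseq xs ys"
  obtains i where "strict_mono_on {..<length xs} i" "\<forall>a<length xs. i a < length ys"
    "\<forall>a<length xs. ys ! i a = xs ! a"
  using assms
proof (induction arbitrary: thesis rule: list_emb.induct)
  case (list_emb_Nil ys)
  show ?case by (rule list_emb_Nil[of id]) auto
next
  case (list_emb_Cons xs ys y)
  obtain i where "strict_mono_on {..<length xs} i" "\<forall>a<length xs. i a < length ys"
    "\<forall>a<length xs. ys ! i a = xs ! a"
    using list_emb_Cons.IH by metis
  then show ?case
    by (intro list_emb_Cons.prems[of "\<lambda>a. Suc (i a)"]) (auto simp: monotone_on_def)
next
  case (list_emb_Cons2 x y xs ys)
  obtain i where "strict_mono_on {..<length xs} i" "\<forall>a<length xs. i a < length ys"
    "\<forall>a<length xs. ys ! i a = xs ! a"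
    using list_emb_Cons2.IH by metis
  then show ?case using list_emb_Cons2.hyps
    \<comment> \<open>The matched head receives index 0 and all indices of the tail shift by
      one.\<close>
    by (intro list_emb_Cons2.prems[of "\<lambda>a. case a of 0 \<Rightarrow> 0 | Suc b \<Rightarrow> Suc (i b)"])
      (auto simp: monotone_on_def split: nat.splits)
qed

lemma contains_pattern_iff_subseq:
  "contains_pattern w \<rho> \<longleftrightarrow> (\<exists>s. subseq s w \<and> length s = length \<rho> \<and>
     (\<forall>a<length \<rho>. \<forall>b<length \<rho>. (s ! a < s ! b \<longleftrightarrow> \<rho> ! a < \<rho> ! b) \<and> (s ! a > s ! b \<longleftrightarrow> \<rho> ! a > \<rho> ! b)))"
  (is "?l \<longleftrightarrow> ?r")
proof
  assume ?l
  then obtain i where "strict_mono_on {..<length \<rho>} i" "\<forall>a<length \<rho>. i a < length w"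
    "\<forall>a<length \<rho>. \<forall>b<length \<rho>.
       (w ! i a < w ! i b \<longleftrightarrow> \<rho> ! a < \<rho> ! b) \<and> (w ! i a > w ! i b \<longleftrightarrow> \<rho> ! a > \<rho> ! b)"
    unfolding contains_pattern_def by blast
  then show ?r
    by (intro exI[of _ "map (\<lambda>a. w ! i a) [0..<length \<rho>]"]) (simp add: subseq_map_nth)
next
  assume ?r
  then obtain s where s: "subseq s w" "length s = length \<rho>"
     "\<forall>a<length \<rho>. \<forall>b<length \<rho>. (s ! a < s ! b \<longleftrightarrow> \<rho> ! a < \<rho> ! b) \<and> (s ! a > s ! b \<longleftrightarrow> \<rho> ! a > \<rho> ! b)"
    by blast
  obtain i where "strict_mono_on {..<length s} i" "\<forall>a<length s. i a < length w"
    "\<forall>a<length s. w ! i a = s ! a"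
    using s(1) by (rule subseq_obtain_indices)
  then show ?l
    unfolding contains_pattern_def using s by (intro exI[of _ i]) auto
qed

lemma contains_112: "contains_pattern w [1,1,2] \<longleftrightarrow> (\<exists>x y. x < y \<and> subseq [x,x,y] w)"
  and contains_121: "contains_pattern w [1,2,1] \<longleftrightarrow> (\<exists>x y. x < y \<and> subseq [x,y,x] w)"
  unfolding contains_pattern_iff_subseq
  by (fastforce simp: length_Suc_conv All_less_Suc numeral_eq_Suc)+

lemma contains_1231: "contains_pattern w [1,2,3,1] \<longleftrightarrow> (\<exists>x y z. x < y \<and> y < z \<and> subseq [x,y,z,x] w)"
  and contains_1132: "contains_pattern w [1,1,3,2] \<longleftrightarrow> (\<exists>x y z. x < y \<and> y < z \<and> subseq [x,x,z,y] w)"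
  unfolding contains_pattern_iff_subseq
  by (fastforce simp: length_Suc_conv All_less_Suc numeral_eq_Suc)+

section \<open>Initial runs\<close>

text \<open>The statistic \<open>d\<close> on reversed words, with \<open>(\<le>)\<close> for the
  first class and \<open>(\<ge>)\<close> for the second. Only neighbours are compared, which makes
  the value easy to follow through concatenation; for transitive \<open>R\<close> it is the length
  of the longest sorted prefix.\<close>

fun run :: "('a \<Rightarrow> 'a \<Rightarrow> bool) \<Rightarrow> 'a list \<Rightarrow> nat" where
  "run R [] = 0"
| "run R [x] = 1"
| "run R (x # y # zs) = (if R x y then Suc (run R (y # zs)) else 1)"

lemma run_le_length: "run R xs \<le> length xs"
  by (induction R xs rule: run.induct) auto

text \<open>Transitivity extends comparisons of neighbours to all pairs. The bound on
  \<open>p\<close> matters because \<open>take p xs\<close> no longer changes beyond the length of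
  \<open>xs\<close>.\<close>

lemma le_run_iff_sorted_take:
  assumes "transp R" "p \<le> length xs"
  shows "p \<le> run R xs \<longleftrightarrow> sorted_wrt R (take p xs)"
  using assms
proof (induction R xs arbitrary: p rule: run.induct)
  case (2 R x)
  then show ?case by (cases p) auto
next
  case (3 R x y zs)
  show ?case
  proof (cases p)
    case (Suc q)
    show ?thesis
    proof (cases q)
      case (Suc r)
      have "sorted_wrt R (take p (x # y # zs)) \<longleftrightarrow> R x y \<and> sorted_wrt R (take q (y # zs))"
        using \<open>p = Suc q\<close> Suc transpD[OF 3(2)] by auto
      then show ?thesis using 3 \<open>p = Suc q\<close> Suc by auto
    qed (use Suc in auto)
  qed simp
qed simp

text \<open>The first of three cases for a concatenation: the run stops inside \<open>us\<close>.
  The next two lemmas treat a break at the junction and a run that passes through it.\<close>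

lemma run_append_not_sorted:
  "run R us < length us \<Longrightarrow> run R (us @ vs) = run R us"
  by (induction R us rule: run.induct) auto

lemma run_append_break:
  "us \<noteq> [] \<Longrightarrow> \<not> R (last us) y \<Longrightarrow> run R (us @ y # vs) = run R us"
  by (induction R us rule: run.induct) auto

lemma run_append_glue:
  "run R us = length us \<Longrightarrow> vs \<noteq> [] \<Longrightarrow> us = [] \<or> R (last us) (hd vs) \<Longrightarrow>
    run R (us @ vs) = length us + run R vs"
  by (induction R us rule: run.induct) (auto split: if_splits simp: neq_Nil_conv)

lemma run_take: "run R (take p xs) = min p (run R xs)"
proof (induction R xs arbitrary: p rule: run.induct)
  case (2 R x)
  then show ?case by (cases p) auto
next
  case (3 R x y zs)
  show ?case
  proof (cases p)
    case (Suc q)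
    then show ?thesis using 3[of q] by (cases q) auto
  qed simp
qed simp

lemma run_replicate: "(R x x) \<Longrightarrow> run R (replicate n x) = n"
proof (induction n)
  case (Suc n)
  then show ?case by (cases n) auto
qed simp

lemma run_replicate_append:
  assumes "R x x" "\<forall>y\<in>set ys. R x y"
  shows "run R (replicate n x @ ys) = n + run R ys"
proof (cases "ys = []")
  case False
  then show ?thesis using assms
    by (cases n) (auto simp: run_append_glue run_replicate last_replicate simp del: replicate_Suc)
qed (simp add: run_replicate assms)

section \<open>Removing the smallest letter\<close>

text \<open>The patterns are reversed: these are the reverses of the avoiding words.\<close>

definition avoidsP :: "nat list \<Rightarrow> bool" where
  "avoidsP w \<longleftrightarrow> (\<forall>x y. x < y \<longrightarrow> \<not> subseq [y,x,x] w) \<and>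
     (\<forall>x y z. x < y \<longrightarrow> y < z \<longrightarrow> \<not> subseq [x,z,y,x] w)"

definition avoidsQ :: "nat list \<Rightarrow> bool" where
  "avoidsQ w \<longleftrightarrow> (\<forall>x y. x < y \<longrightarrow> \<not> subseq [x,y,x] w) \<and>
     (\<forall>x y z. x < y \<longrightarrow> y < z \<longrightarrow> \<not> subseq [y,z,x,x] w)"

text \<open>In both patterns \<open>x\<close> is the smallest letter. If \<open>x\<close> differs
  from \<open>m\<close>, the occurrence uses only letters above \<open>m\<close> and survives the
  deletion of \<open>m\<close>; hence only the occurrences with \<open>x = m\<close> need separate
  conditions.\<close>

lemma avoidsP_filter_min:
  assumes "\<forall>x\<in>set w. m \<le> x"
  shows "avoidsP w \<longleftrightarrow> avoidsP (filter (\<lambda>x. x \<noteq> m) w) \<and> (\<forall>y>m. \<not> subseq [y,m,m] w) \<and>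
    (\<forall>y z. m < y \<longrightarrow> y < z \<longrightarrow> \<not> subseq [m,z,y,m] w)" (is "_ \<longleftrightarrow> ?r")
proof
  show "avoidsP w \<Longrightarrow> ?r"
    unfolding avoidsP_def by (meson subseq_filter_left subseq_order.trans)
next
  assume r: ?r
  have ge: "m \<le> x" if "subseq xs w" "x \<in> set xs" for x xs
    using subseq_set[OF that(1)] that(2) assms by auto
  have filt: "subseq xs (filter (\<lambda>x. x \<noteq> m) w)" if "subseq xs w" "m \<notin> set xs" for xs
    using that by (subst subseq_filter_iff) auto
  show "avoidsP w"
    unfolding avoidsP_def
  proof (intro conjI allI impI notI)
    fix x y assume xy: "x < y" "subseq [y,x,x] w"
    then show False using r ge[OF xy(2), of x] filt[OF xy(2)]
      by (cases "x = m") (auto simp: avoidsP_def)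
  next
    fix x y z assume xy: "x < y" "y < z" "subseq [x,z,y,x] w"
    then show False using r ge[OF xy(3), of x] filt[OF xy(3)]
      by (cases "x = m") (auto simp: avoidsP_def)
  qed
qed

text \<open>Again \<open>x\<close> is the smallest letter of each pattern, so an occurrence either
  has \<open>x = m\<close> or survives the deletion of \<open>m\<close>.\<close>

lemma avoidsQ_filter_min:
  assumes "\<forall>x\<in>set w. m \<le> x"
  shows "avoidsQ w \<longleftrightarrow> avoidsQ (filter (\<lambda>x. x \<noteq> m) w) \<and> (\<forall>y>m. \<not> subseq [m,y,m] w) \<and>
    (\<forall>y z. m < y \<longrightarrow> y < z \<longrightarrow> \<not> subseq [y,z,m,m] w)" (is "_ \<longleftrightarrow> ?r")
proof
  show "avoidsQ w \<Longrightarrow> ?r"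
    unfolding avoidsQ_def by (meson subseq_filter_left subseq_order.trans)
next
  assume r: ?r
  have ge: "m \<le> x" if "subseq xs w" "x \<in> set xs" for x xs
    using subseq_set[OF that(1)] that(2) assms by auto
  have filt: "subseq xs (filter (\<lambda>x. x \<noteq> m) w)" if "subseq xs w" "m \<notin> set xs" for xs
    using that by (subst subseq_filter_iff) auto
  show "avoidsQ w"
    unfolding avoidsQ_def
  proof (intro conjI allI impI notI)
    fix x y assume xy: "x < y" "subseq [x,y,x] w"
    then show False using r ge[OF xy(2), of x] filt[OF xy(2)]
      by (cases "x = m") (auto simp: avoidsQ_def)
  next
    fix x y z assume xy: "x < y" "y < z" "subseq [y,z,x,x] w"
    then show False using r ge[OF xy(3), of x] filt[OF xy(3)]
      by (cases "x = m") (auto simp: avoidsQ_def)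
  qed
qed

text \<open>Only one \<open>m\<close> stands behind a larger letter, which excludes
  \<open>[y,m,m]\<close>. An occurrence of \<open>[m,z,y,m]\<close> has to start in the leading
  block and end at the last \<open>m\<close>, so for \<open>c > 0\<close> it amounts to a descent
  \<open>z > y\<close> in \<open>us\<close>; for \<open>c = 0\<close> there is only one
  \<open>m\<close>.\<close>

lemma avoidsP_insert_min:
  assumes gt: "\<forall>x\<in>set us. m < x" "\<forall>x\<in>set vs. m < x"
  shows "avoidsP (replicate c m @ us @ m # vs) \<longleftrightarrow>
    avoidsP (us @ vs) \<and> (c = 0 \<or> sorted_wrt (\<le>) us)"
proof -
  let ?w = "replicate c m @ us @ m # vs"
  have notin: "m \<notin> set us" "m \<notin> set vs" using gt by auto
  have "filter (\<lambda>x. x \<noteq> m) ?w = us @ vs"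
    using notin by (auto intro!: arg_cong2[where f = append] filter_True)
  moreover have "\<not> subseq [y,m,m] ?w" if "y > m" for y
  proof -
    have "subseq [y,m,m] ?w \<longleftrightarrow> subseq [y,m,m] (us @ m # vs)"
      using that by (intro subseq_Cons_append_notin) auto
    also have "\<not> \<dots>"
      using subseq_count_list_le[of "[y,m,m]" "us @ m # vs" m] notin that
      by auto
    finally show ?thesis .
  qed
  moreover have "(\<forall>y z. m < y \<longrightarrow> y < z \<longrightarrow> \<not> subseq [m,z,y,m] ?w) \<longleftrightarrow> c = 0 \<or> sorted_wrt (\<le>) us"
  proof (cases c)
    case 0
    have "\<not> subseq [m,z,y,m] ?w" for y z
      using subseq_count_list_le[of "[m,z,y,m]" "us @ m # vs" m] notin 0
      by (auto split: if_splits)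
    then show ?thesis using 0 by simp
  next
    case (Suc d)
    have "subseq [m,z,y,m] ?w \<longleftrightarrow> subseq [z,y] us" if "m < y" "y < z" for y z
    proof -
      have "subseq [m,z,y,m] ?w \<longleftrightarrow> subseq [z,y,m] (replicate d m @ us @ m # vs)"
        using Suc by simp
      also have "\<dots> \<longleftrightarrow> subseq [z,y,m] (us @ m # vs)"
        using that by (intro subseq_Cons_append_notin) auto
      also have "\<dots> \<longleftrightarrow> subseq [z,y] us"
        using subseq_snoc_append_Cons[OF notin(2), of "[z,y]" us] by simp
      finally show ?thesis .
    qed
    moreover have "m < y" if "subseq [z,y] us" for y z
      using subseq_set[OF that] gt by auto
    ultimately show ?thesis
      using Suc by (auto simp: sorted_wrt_iff_subseq) (meson leD not_le)+
  qed
  moreover have "\<forall>x\<in>set ?w. m \<le> x" using gt by (auto simp: less_imp_le)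
  ultimately show ?thesis by (subst avoidsP_filter_min[of _ m]) simp_all
qed

text \<open>The copies of \<open>m\<close> form one block, which excludes \<open>[m,y,m]\<close>.
  With at least two copies, \<open>[y,z,m,m]\<close> occurs exactly when \<open>us\<close> has an
  ascent \<open>y < z\<close>; a single copy cannot supply both letters \<open>m\<close>.\<close>

lemma avoidsQ_insert_min:
  assumes gt: "\<forall>x\<in>set us. m < x" "\<forall>x\<in>set vs. m < x"
  shows "avoidsQ (us @ replicate (Suc c) m @ vs) \<longleftrightarrow>
    avoidsQ (us @ vs) \<and> (c = 0 \<or> sorted_wrt (\<ge>) us)"
proof -
  let ?w = "us @ replicate (Suc c) m @ vs"
  have notin: "m \<notin> set us" "m \<notin> set vs" using gt by auto
  have "filter (\<lambda>x. x \<noteq> m) ?w = us @ vs"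
    using notin by (auto intro!: arg_cong2[where f = append] filter_True)
  moreover have "\<not> subseq [m,y,m] ?w" if "y > m" for y
  proof -
    have "subseq [m,y,m] ?w \<longleftrightarrow> subseq [m,y,m] (m # replicate c m @ vs)"
      using subseq_Cons_append_notin[OF notin(1)] by simp
    also have "\<dots> \<longleftrightarrow> subseq [y,m] (replicate c m @ vs)" by simp
    also have "\<dots> \<longleftrightarrow> subseq [y,m] vs"
      using that by (intro subseq_Cons_append_notin) auto
    also have "\<not> \<dots>" using subseq_set[of "[y,m]" vs] notin by auto
    finally show ?thesis .
  qed
  moreover have "(\<forall>y z. m < y \<longrightarrow> y < z \<longrightarrow> \<not> subseq [y,z,m,m] ?w) \<longleftrightarrow> c = 0 \<or> sorted_wrt (\<ge>) us"
  proof (cases c)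
    case 0
    have "\<not> subseq [y,z,m,m] ?w" for y z
      using subseq_count_list_le[of "[y,z,m,m]" "us @ m # vs" m] notin 0
      by (auto split: if_splits)
    then show ?thesis using 0 by simp
  next
    case (Suc d)
    \<comment> \<open>The last two copies of \<open>m\<close> are split off: they can always serve
      as the final \<open>m,m\<close> of an occurrence.\<close>
    have w: "?w = (us @ replicate d m) @ m # m # vs"
      using Suc by (simp add: replicate_app_Cons_same)
    have "subseq [y,z,m,m] ?w \<longleftrightarrow> subseq [y,z] us" if "m < y" "y < z" for y z
    proof -
      have "subseq [y,z,m,m] ?w \<longleftrightarrow> subseq [y,z,m] ((us @ replicate d m) @ m # [])"
        unfolding w using subseq_snoc_append_Cons[OF notin(2), of "[y,z,m]" "(us @ replicate d m) @ [m]"] by simp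
      also have "\<dots> \<longleftrightarrow> subseq [y,z] (us @ replicate d m)"
        using subseq_snoc_append_Cons[of m "[]" "[y,z]" "us @ replicate d m"] by simp
      also have "\<dots> \<longleftrightarrow> subseq [y,z] us"
        using subseq_snoc_append_notin[of z "replicate d m" "[y]" us] that by simp
      finally show ?thesis .
    qed
    moreover have "m < y" if "subseq [y,z] us" for y z
      using subseq_set[OF that] gt by auto
    ultimately show ?thesis
      using Suc by (auto simp: sorted_wrt_iff_subseq) (meson leD not_le)+
  qed
  moreover have "\<forall>x\<in>set ?w. m \<le> x" using gt by (auto simp: less_imp_le)
  ultimately show ?thesis by (subst avoidsQ_filter_min[of _ m]) simp_all
qed

text \<open>Avoiding \<open>[y,m,m]\<close> forces this shape: after the first larger letter at most
  one \<open>m\<close> may follow. If all copies are in front, \<open>us\<close> is empty.\<close>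

lemma avoidsP_obtain_min:
  assumes "avoidsP w" "\<forall>x\<in>set w. m \<le> x" "m \<in> set w"
  obtains c us vs where "w = replicate c m @ us @ m # vs" "m \<notin> set us" "m \<notin> set vs"
proof -
  obtain xs vs where w: "w = xs @ m # vs" "m \<notin> set vs"
    using split_list_last[OF assms(3)] by blast
  \<comment> \<open>Cutting at the last \<open>m\<close> and stripping the leading block leaves
    \<open>us\<close>. A further \<open>m\<close> in it would stand between its first letter
    \<open>y > m\<close> and the last \<open>m\<close>, giving \<open>[y,m,m]\<close>.\<close>
  let ?us = "dropWhile (\<lambda>x. x = m) xs"
  have xs: "xs = replicate (length (takeWhile (\<lambda>x. x = m) xs)) m @ ?us"
    by (subst replicate_length_same) (auto dest: set_takeWhileD)
  have "m \<notin> set ?us"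
  proof
    assume m: "m \<in> set ?us"
    then obtain y ys where ys: "?us = y # ys" "y \<noteq> m"
      by (cases ?us) (auto simp: dropWhile_eq_Cons_conv)
    then have "y \<in> set xs" by (metis list.set_intros(1) set_dropWhileD)
    then have "y > m" using assms(2)[rule_format, of y] ys(2) w by auto
    have "subseq [m] ys" using m ys by (simp add: subseq_singleton_left)
    then have "subseq ([y,m] @ [m]) (?us @ m # vs)"
      using ys by (intro list_emb_append_mono) auto
    then have "subseq [y,m,m] w"
      unfolding w by (subst xs) (simp add: subseq_drop_many)
    then show False using assms(1) \<open>y > m\<close> by (auto simp: avoidsP_def)
  qed
  then show thesis using that w xs by (metis append.assoc)
qed

text \<open>Cutting at the first \<open>m\<close> and removing the block that starts there, a
  further \<open>m\<close> would enclose a larger letter and give \<open>[m,y,m]\<close>.\<close>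

lemma avoidsQ_obtain_min:
  assumes "avoidsQ w" "\<forall>x\<in>set w. m \<le> x" "m \<in> set w"
  obtains c us vs where "w = us @ replicate (Suc c) m @ vs" "m \<notin> set us" "m \<notin> set vs"
proof -
  obtain us xs where w: "w = us @ m # xs" "m \<notin> set us"
    using split_list_first[OF assms(3)] by blast
  let ?vs = "dropWhile (\<lambda>x. x = m) xs"
  have xs: "xs = replicate (length (takeWhile (\<lambda>x. x = m) xs)) m @ ?vs"
    by (subst replicate_length_same) (auto dest: set_takeWhileD)
  have "m \<notin> set ?vs"
  proof
    assume m: "m \<in> set ?vs"
    then obtain y ys where ys: "?vs = y # ys" "y \<noteq> m"
      by (cases ?vs) (auto simp: dropWhile_eq_Cons_conv)
    then have "y \<in> set xs" by (metis list.set_intros(1) set_dropWhileD)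
    then have "y > m" using assms(2)[rule_format, of y] ys(2) w by auto
    have "subseq [m] ys" using m ys by (simp add: subseq_singleton_left)
    then have "subseq [y,m] ?vs" using ys by auto
    then have "subseq [m,y,m] w"
      unfolding w by (subst xs) (simp add: subseq_drop_many)
    then show False using assms(1) \<open>y > m\<close> by (auto simp: avoidsQ_def)
  qed
  then show thesis using that w xs by (metis append_Cons replicate_Suc)
qed

section \<open>Insertion maps and their effect on runs\<close>

text \<open>The multiplicity of \<open>m\<close> is \<open>Suc c\<close>.\<close>

definition insertP :: "nat \<Rightarrow> nat \<Rightarrow> nat \<Rightarrow> nat list \<Rightarrow> nat list" where
  "insertP c m p w = replicate c m @ take p w @ m # drop p w"

definition insertQ :: "nat \<Rightarrow> nat \<Rightarrow> nat \<Rightarrow> nat list \<Rightarrow> nat list" where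
  "insertQ c m p w = take p w @ replicate (Suc c) m @ drop p w"

text \<open>At \<open>p = 0\<close> all \<open>Suc c\<close> copies stand in front and lengthen the
  run of \<open>w\<close>. Otherwise the last \<open>m\<close> follows a larger letter and cuts the
  run at \<open>p\<close>, while the \<open>c\<close> copies in front lengthen it.\<close>

lemma run_insertP:
  assumes gt: "\<forall>x\<in>set w. m < x" and p: "p \<le> length w"
  shows "run (\<le>) (insertP c m p w) = (if p = 0 then run (\<le>) w + Suc c else min p (run (\<le>) w) + c)"
proof (cases "p = 0")
  case True
  then have "insertP c m p w = replicate (Suc c) m @ w"
    by (simp add: insertP_def replicate_app_Cons_same)
  then show ?thesis
    using True gt run_replicate_append[of "(\<le>)" m w "Suc c"] by (auto simp: less_imp_le)
next
  case False
  let ?v = "take p w @ m # drop p w"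
  have ne: "take p w \<noteq> []" using False p by auto
  then have "last (take p w) \<in> set w" by (meson in_set_takeD last_in_set)
  then have "\<not> last (take p w) \<le> m" using gt by auto
  then have "run (\<le>) ?v = min p (run (\<le>) w)"
    using run_append_break[OF ne, of "(\<le>)" m] by (simp add: run_take)
  moreover have "\<forall>x\<in>set ?v. m \<le> x" using gt
    by (auto dest!: in_set_takeD in_set_dropD simp: less_imp_le)
  ultimately show ?thesis
    using False run_replicate_append[of "(\<le>)" m ?v c] by (simp add: insertP_def)
qed

text \<open>If \<open>take p w\<close> is weakly decreasing, the run continues through the block of
  copies of \<open>m\<close> and stops at the next larger letter. Otherwise it ends before the block
  is reached.\<close>

lemma run_insertQ:
  assumes gt: "\<forall>x\<in>set w. m < x" and p: "p \<le> length w"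
  shows "run (\<ge>) (insertQ c m p w) = (if p \<le> run (\<ge>) w then p + Suc c else run (\<ge>) w)"
proof (cases "p \<le> run (\<ge>) w")
  case True
  let ?v = "replicate (Suc c) m @ drop p w"
  have "take p w = [] \<or> hd ?v \<le> last (take p w)"
    using gt by (metis hd_append2 hd_replicate in_set_takeD last_in_set less_imp_le nat.simps(3) replicate_empty)
  then have "run (\<ge>) (insertQ c m p w) = p + run (\<ge>) ?v"
    unfolding insertQ_def using True p by (subst run_append_glue) (auto simp: run_take)
  moreover have "run (\<ge>) ?v = Suc c"
  proof (cases "drop p w")
    case Nil
    then show ?thesis by (simp add: run_replicate del: replicate_Suc)
  next
    case (Cons y ys)
    then have "y \<in> set w" by (metis in_set_dropD list.set_intros(1))
    then have "\<not> m \<ge> y" using gt by auto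
    then show ?thesis
      unfolding Cons by (subst run_append_break) (auto simp: run_replicate last_replicate simp del: replicate_Suc)
  qed
  ultimately show ?thesis using True by simp
next
  case False
  then show ?thesis
    unfolding insertQ_def using p by (subst run_append_not_sorted) (auto simp: run_take)
qed

section \<open>Insertion as a bijection between classes\<close>

definition wordsP :: "nat multiset \<Rightarrow> nat list set" where
  "wordsP S = {w \<in> permutations_of_multiset S. avoidsP w}"

definition wordsQ :: "nat multiset \<Rightarrow> nat list set" where
  "wordsQ S = {w \<in> permutations_of_multiset S. avoidsQ w}"

text \<open>The last admissible insertion position. Here \<open>c\<close> counts the copies of
  \<open>m\<close> beyond the first, so \<open>c = 0\<close> is the case of a single copy, without
  restriction.\<close>

definition max_pos :: "(nat \<Rightarrow> nat \<Rightarrow> bool) \<Rightarrow> nat \<Rightarrow> nat list \<Rightarrow> nat" where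
  "max_pos R c w = (if c = 0 then length w else run R w)"

lemma le_max_pos_iff:
  assumes "transp R"
  shows "p \<le> max_pos R c w \<longleftrightarrow> p \<le> length w \<and> (c = 0 \<or> sorted_wrt R (take p w))"
  using le_run_iff_sorted_take[OF assms, of p w] run_le_length[of R w]
  by (auto simp: max_pos_def)

lemma mset_take_drop: "mset (take p w) + mset (drop p w) = mset w"
  by (metis append_take_drop_id mset_append)

text \<open>The prefix ends at the first \<open>m\<close>, so the insertion position can be read off
  the word.\<close>

lemma take_append_Cons_eqD:
  assumes "take p w @ m # xs = take q w @ m # ys" "m \<notin> set w" "p \<le> length w" "q \<le> length w"
  shows "p = q"
proof -
  have "takeWhile (\<lambda>x. x \<noteq> m) (take r w @ m # zs) = take r w" for r zs
    using assms(2) by (subst takeWhile_append2) (auto dest: in_set_takeD)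
  then have "take p w = take q w" using assms(1) by metis
  then show ?thesis using assms(3,4) by (metis length_take min.absorb2)
qed

text \<open>Injectivity: deleting \<open>m\<close> recovers \<open>w\<close>, and the position of
  the last \<open>m\<close> then recovers \<open>p\<close>. Surjectivity:
  \<open>avoidsP_obtain_min\<close> gives the shape and \<open>avoidsP_insert_min\<close> the
  admissibility of the position.\<close>

lemma bij_betw_insertP:
  assumes gt: "\<forall>x\<in>#T. m < x"
  shows "bij_betw (\<lambda>(w, p). insertP c m p w) (SIGMA w:wordsP T. {..max_pos (\<le>) c w})
    (wordsP (T + replicate_mset (Suc c) m))" (is "bij_betw ?f ?A ?B")
proof (rule bij_betw_imageI)
  have mem: "m \<notin> set w \<and> (\<forall>x\<in>set w. m < x) \<and> mset w = T" if "w \<in> wordsP T" for w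
    using that gt by (auto simp: wordsP_def permutations_of_multiset_def)
  have filt: "filter (\<lambda>x. x \<noteq> m) (insertP c m p w) = w" if "m \<notin> set w" for w p
  proof -
    have "filter (\<lambda>x. x \<noteq> m) (take p w) = take p w" "filter (\<lambda>x. x \<noteq> m) (drop p w) = drop p w"
      using that by (auto intro!: filter_True dest: in_set_takeD in_set_dropD)
    then show ?thesis by (simp add: insertP_def)
  qed
  show "inj_on ?f ?A"
  proof (rule inj_onI, clarify)
    fix w p w' p'
    assume *: "w \<in> wordsP T" "p \<le> max_pos (\<le>) c w" "w' \<in> wordsP T" "p' \<le> max_pos (\<le>) c w'"
      and eq: "insertP c m p w = insertP c m p' w'"
    have "w = w'" using filt mem * eq by metis
    moreover have "p = p'"
      using take_append_Cons_eqD[of p w m _ p'] eq mem[OF *(1)] *(2,4) \<open>w = w'\<close>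
      by (auto simp: insertP_def le_max_pos_iff)
    ultimately show "w = w' \<and> p = p'" by simp
  qed
  show "?f ` ?A = ?B"
  proof (intro equalityI subsetI)
    fix v assume "v \<in> ?f ` ?A"
    then obtain w p where w: "w \<in> wordsP T" "p \<le> max_pos (\<le>) c w" "v = insertP c m p w"
      by auto
    have "avoidsP v"
      unfolding w(3) insertP_def using w(1,2) mem[OF w(1)]
      by (subst avoidsP_insert_min) (auto simp: le_max_pos_iff wordsP_def dest: in_set_takeD in_set_dropD)
    moreover have "mset v = T + replicate_mset (Suc c) m"
      unfolding w(3) insertP_def using mem[OF w(1)] mset_take_drop[of p w] by auto
    ultimately show "v \<in> ?B" by (simp add: wordsP_def permutations_of_multiset_def)
  next
    fix v assume "v \<in> ?B"
    then have v: "avoidsP v" "mset v = T + replicate_mset (Suc c) m"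
      by (auto simp: wordsP_def permutations_of_multiset_def)
    have set_v: "set v = insert m (set_mset T)"
      using arg_cong[OF v(2), of set_mset] by simp
    have "\<forall>x\<in>set v. m \<le> x" "m \<in> set v" using set_v gt by (auto simp: less_imp_le)
    then obtain d us vs where d: "v = replicate d m @ us @ m # vs" "m \<notin> set us" "m \<notin> set vs"
      by (elim avoidsP_obtain_min[OF v(1)])
    \<comment> \<open>Counting \<open>m\<close> in two ways identifies the length \<open>d\<close>
      of the leading block with \<open>c\<close>.\<close>
    have "count (mset v) m = Suc d" using d by (simp add: count_eq_zero_iff)
    moreover have "count (mset v) m = Suc c" using v(2) gt by (auto simp: count_eq_zero_iff)
    ultimately have "d = c" by simp
    have gt': "\<forall>x\<in>set us. m < x" "\<forall>x\<in>set vs. m < x"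
      using d set_v gt by auto
    have av: "avoidsP (us @ vs)" "c = 0 \<or> sorted_wrt (\<le>) us"
      using v(1) d(1) \<open>d = c\<close> avoidsP_insert_min[OF gt'] by auto
    have "mset (us @ vs) = T" using v(2) d(1) \<open>d = c\<close> by simp
    then have "us @ vs \<in> wordsP T" using av by (simp add: wordsP_def permutations_of_multiset_def)
    moreover have "length us \<le> max_pos (\<le>) c (us @ vs)" using av by (simp add: le_max_pos_iff)
    moreover have "v = insertP c m (length us) (us @ vs)" using d(1) \<open>d = c\<close> by (simp add: insertP_def)
    ultimately show "v \<in> ?f ` ?A" by (intro image_eqI[of _ _ "(us @ vs, length us)"]) auto
  qed
qed

text \<open>As for \<open>insertP\<close>, except that the start of the block of copies of
  \<open>m\<close> determines \<open>p\<close>.\<close>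

lemma bij_betw_insertQ:
  assumes gt: "\<forall>x\<in>#T. m < x"
  shows "bij_betw (\<lambda>(w, p). insertQ c m p w) (SIGMA w:wordsQ T. {..max_pos (\<ge>) c w})
    (wordsQ (T + replicate_mset (Suc c) m))" (is "bij_betw ?f ?A ?B")
proof (rule bij_betw_imageI)
  have mem: "m \<notin> set w \<and> (\<forall>x\<in>set w. m < x) \<and> mset w = T" if "w \<in> wordsQ T" for w
    using that gt by (auto simp: wordsQ_def permutations_of_multiset_def)
  have filt: "filter (\<lambda>x. x \<noteq> m) (insertQ c m p w) = w" if "m \<notin> set w" for w p
  proof -
    have "filter (\<lambda>x. x \<noteq> m) (take p w) = take p w" "filter (\<lambda>x. x \<noteq> m) (drop p w) = drop p w"
      using that by (auto intro!: filter_True dest: in_set_takeD in_set_dropD)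
    then show ?thesis by (simp add: insertQ_def)
  qed
  show "inj_on ?f ?A"
  proof (rule inj_onI, clarify)
    fix w p w' p'
    assume *: "w \<in> wordsQ T" "p \<le> max_pos (\<ge>) c w" "w' \<in> wordsQ T" "p' \<le> max_pos (\<ge>) c w'"
      and eq: "insertQ c m p w = insertQ c m p' w'"
    have "w = w'" using filt mem * eq by metis
    moreover have "p = p'"
      using take_append_Cons_eqD[of p w m _ p'] eq mem[OF *(1)] *(2,4) \<open>w = w'\<close>
      by (auto simp: insertQ_def le_max_pos_iff)
    ultimately show "w = w' \<and> p = p'" by simp
  qed
  show "?f ` ?A = ?B"
  proof (intro equalityI subsetI)
    fix v assume "v \<in> ?f ` ?A"
    then obtain w p where w: "w \<in> wordsQ T" "p \<le> max_pos (\<ge>) c w" "v = insertQ c m p w"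
      by auto
    have "avoidsQ v"
      unfolding w(3) insertQ_def using w(1,2) mem[OF w(1)]
      by (subst avoidsQ_insert_min) (auto simp: le_max_pos_iff wordsQ_def dest: in_set_takeD in_set_dropD)
    moreover have "mset v = T + replicate_mset (Suc c) m"
      unfolding w(3) insertQ_def using mem[OF w(1)] mset_take_drop[of p w] by auto
    ultimately show "v \<in> ?B" by (simp add: wordsQ_def permutations_of_multiset_def)
  next
    fix v assume "v \<in> ?B"
    then have v: "avoidsQ v" "mset v = T + replicate_mset (Suc c) m"
      by (auto simp: wordsQ_def permutations_of_multiset_def)
    have set_v: "set v = insert m (set_mset T)"
      using arg_cong[OF v(2), of set_mset] by simp
    have "\<forall>x\<in>set v. m \<le> x" "m \<in> set v" using set_v gt by (auto simp: less_imp_le)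
    then obtain d us vs where d: "v = us @ replicate (Suc d) m @ vs" "m \<notin> set us" "m \<notin> set vs"
      by (elim avoidsQ_obtain_min[OF v(1)])
    have "count (mset v) m = Suc d" using d by (simp add: count_eq_zero_iff)
    moreover have "count (mset v) m = Suc c" using v(2) gt by (auto simp: count_eq_zero_iff)
    ultimately have "d = c" by simp
    have gt': "\<forall>x\<in>set us. m < x" "\<forall>x\<in>set vs. m < x"
      using d set_v gt by auto
    have av: "avoidsQ (us @ vs)" "c = 0 \<or> sorted_wrt (\<ge>) us"
      using v(1) d(1) \<open>d = c\<close> avoidsQ_insert_min[OF gt'] by auto
    have "mset (us @ vs) = T" using v(2) d(1) \<open>d = c\<close> by simp
    then have "us @ vs \<in> wordsQ T" using av by (simp add: wordsQ_def permutations_of_multiset_def)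
    moreover have "length us \<le> max_pos (\<ge>) c (us @ vs)" using av by (simp add: le_max_pos_iff)
    moreover have "v = insertQ c m (length us) (us @ vs)" using d(1) \<open>d = c\<close> by (simp add: insertQ_def)
    ultimately show "v \<in> ?f ` ?A" by (intro image_eqI[of _ _ "(us @ vs, length us)"]) auto
  qed
qed

section \<open>The bijection\<close>

text \<open>Chosen such that \<open>insertQ\<close> at position \<open>match_pos d p\<close> produces the same run as \<open>insertP\<close> at
  position \<open>p\<close>, if both words have run \<open>d\<close> before the insertion.\<close>

definition match_pos :: "nat \<Rightarrow> nat \<Rightarrow> nat" where
  "match_pos d p = (if p = 0 then d else if p \<le> d then p - 1 else p)"

text \<open>The map rotates \<open>{0..d}\<close> cyclically and fixes all larger numbers; the
  witness is the inverse rotation.\<close>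

lemma bij_betw_match_pos:
  assumes "d \<le> n"
  shows "bij_betw (match_pos d) {..n} {..n}"
  by (rule bij_betw_byWitness[where f' = "\<lambda>q. if q = d then 0 else if q < d then q + 1 else q"])
    (use assms in \<open>auto simp: match_pos_def\<close>)

lemma bij_betw_Sigma_map:
  assumes f: "bij_betw f A B" and g: "\<And>a. a \<in> A \<Longrightarrow> bij_betw (g a) (C a) (D (f a))"
  shows "bij_betw (\<lambda>(a, p). (f a, g a p)) (Sigma A C) (Sigma B D)"
proof (rule bij_betw_imageI)
  show "inj_on (\<lambda>(a, p). (f a, g a p)) (Sigma A C)"
    using bij_betw_imp_inj_on[OF f] bij_betw_imp_inj_on[OF g]
    by (auto simp: inj_on_def)
  show "(\<lambda>(a, p). (f a, g a p)) ` Sigma A C = Sigma B D"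
    using bij_betw_imp_surj_on[OF f] bij_betw_imp_surj_on[OF g]
    by (fastforce simp: image_iff)
qed

text \<open>Take \<open>\<psi>\<close> after \<open>F\<close> after the inverse of
  \<open>\<phi>\<close>. The maps \<open>\<phi>\<close> and \<open>\<psi>\<close> will be the two
  insertions, and \<open>F\<close> the matching of pairs of a smaller word and a position.\<close>

lemma bij_betw_transport:
  assumes \<phi>: "bij_betw \<phi> X A" and "bij_betw \<psi> Y B" "bij_betw F X Y"
    and eq: "\<And>x. x \<in> X \<Longrightarrow> t (\<psi> (F x)) = s (\<phi> x)"
  obtains f where "bij_betw f A B" "\<forall>a\<in>A. t (f a) = s a"
proof -
  let ?i = "inv_into X \<phi>"
  have i: "bij_betw ?i A X" using \<phi> by (rule bij_betw_inv_into)
  then have "bij_betw (\<psi> \<circ> (F \<circ> ?i)) A B"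
    using assms(2,3) by (blast intro: bij_betw_trans)
  moreover have "\<forall>a\<in>A. t ((\<psi> \<circ> (F \<circ> ?i)) a) = s a"
    using eq \<phi> i by (auto simp: bij_betw_inv_into_right bij_betw_apply)
  ultimately show thesis using that by blast
qed

text \<open>Equal cardinality alone would not carry the induction: when the smallest letter is
  repeated, the number of insertion positions depends on the run, so the bijection must preserve
  it.\<close>

lemma ex_run_preserving_bij:
  "\<exists>f. bij_betw f (wordsP S) (wordsQ S) \<and> (\<forall>w\<in>wordsP S. run (\<ge>) (f w) = run (\<le>) w)"
proof (induction S rule: measure_induct_rule[of size])
  case (less S)
  show ?case
  proof (cases "S = {#}")
    case True
    then have "wordsP S = {[]}" "wordsQ S = {[]}"
      by (auto simp: wordsP_def wordsQ_def avoidsP_def avoidsQ_def)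
    then show ?thesis by (intro exI[of _ id]) (auto simp: bij_betw_def)
  next
    case False
    define m where "m = Min (set_mset S)"
    define T where "T = filter_mset (\<lambda>x. x \<noteq> m) S"
    have m: "m \<in># S" "\<forall>x\<in>#S. m \<le> x" using False by (auto simp: m_def)
    define c where "c = count S m - 1"
    have c: "count S m = Suc c" using m(1) by (simp add: c_def)
    have S: "S = T + replicate_mset (Suc c) m"
      unfolding T_def c[symmetric] by (rule multiset_eqI) auto
    have gt: "\<forall>x\<in>#T. m < x" using m(2) by (auto simp: T_def order.strict_iff_order)
    have "size T < size S" by (subst S) simp
    from less.IH[OF this] obtain f where f: "bij_betw f (wordsP T) (wordsQ T)"
      and run_f: "\<And>w. w \<in> wordsP T \<Longrightarrow> run (\<ge>) (f w) = run (\<le>) w" by blast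
    have P: "mset w = T" "\<forall>x\<in>set w. m < x" "length (f w) = length w" "\<forall>x\<in>set (f w). m < x"
      if "w \<in> wordsP T" for w
    proof -
      have "mset w = T" "mset (f w) = T"
        using that bij_betw_apply[OF f that]
        by (auto simp: wordsP_def wordsQ_def permutations_of_multiset_def)
      then show "mset w = T" "\<forall>x\<in>set w. m < x" "length (f w) = length w" "\<forall>x\<in>set (f w). m < x"
        using gt by (auto dest: mset_eq_length simp flip: set_mset_mset)
    qed
    \<comment> \<open>Matched words have the same length and the same run, hence equally many
      insertion positions.\<close>
    have pos: "max_pos (\<ge>) c (f w) = max_pos (\<le>) c w" if "w \<in> wordsP T" for w
      using P[OF that] run_f[OF that] by (simp add: max_pos_def)
    let ?F = "\<lambda>(w, p). (f w, match_pos (run (\<le>) w) p)"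
    have F: "bij_betw ?F (SIGMA w:wordsP T. {..max_pos (\<le>) c w}) (SIGMA w:wordsQ T. {..max_pos (\<ge>) c w})"
    proof (rule bij_betw_Sigma_map[OF f])
      fix w assume "w \<in> wordsP T"
      then show "bij_betw (match_pos (run (\<le>) w)) {..max_pos (\<le>) c w} {..max_pos (\<ge>) c (f w)}"
        using run_le_length[of "(\<le>)" w]
        by (simp add: pos) (auto simp: max_pos_def intro!: bij_betw_match_pos)
    qed
    have "run (\<ge>) ((\<lambda>(w, p). insertQ c m p w) (?F x)) = run (\<le>) ((\<lambda>(w, p). insertP c m p w) x)"
      if "x \<in> (SIGMA w:wordsP T. {..max_pos (\<le>) c w})" for x
    proof -
      obtain w p where x: "x = (w, p)" "w \<in> wordsP T" "p \<le> max_pos (\<le>) c w" using \<open>x \<in> _\<close> by auto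
      have "match_pos (run (\<le>) w) p \<le> max_pos (\<ge>) c (f w)"
        using bij_betw_apply[OF F, of x] x by auto
      then have "match_pos (run (\<le>) w) p \<le> length (f w)" "p \<le> length w"
        using x(3) by (auto simp: le_max_pos_iff)
      \<comment> \<open>With \<open>d\<close> the run of \<open>w\<close>, both new runs are
        \<open>d + Suc c\<close> for \<open>p = 0\<close> and \<open>p + c\<close> for
        \<open>0 < p \<le> d\<close>. For \<open>p > d\<close> they are \<open>d + c\<close> and
        \<open>d\<close>, which agree because this case occurs only with
        \<open>c = 0\<close>.\<close>
      moreover have "c = 0 \<or> p \<le> run (\<le>) w" using x(3) by (auto simp: max_pos_def split: if_splits)
      ultimately show ?thesis
        using P[OF x(2)] run_f[OF x(2)]
        by (auto simp: x(1) run_insertP run_insertQ match_pos_def)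
    qed
    then obtain g where "bij_betw g (wordsP (T + replicate_mset (Suc c) m)) (wordsQ (T + replicate_mset (Suc c) m))"
      "\<forall>w\<in>wordsP (T + replicate_mset (Suc c) m). run (\<ge>) (g w) = run (\<le>) w"
      by (rule bij_betw_transport[where t = "run (\<ge>)" and s = "run (\<le>)",
          OF bij_betw_insertP[OF gt, of c] bij_betw_insertQ[OF gt, of c] F])
    then show ?thesis unfolding S[symmetric] by blast
  qed
qed

section \<open>Return to the unreversed words\<close>

lemma subseq_rev_right: "subseq xs (rev ys) \<longleftrightarrow> subseq (rev xs) ys"
  using subseq_rev_iff[of "rev xs" ys] by simp

lemma av_eq_card_rev:
  assumes "\<And>w. (\<forall>\<rho>\<in>P. avoids_pattern (rev w) \<rho>) \<longleftrightarrow> A w"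
  shows "av S P = card {w \<in> permutations_of_multiset S. A w}"
proof -
  have "{\<pi> \<in> permutations_of_multiset S. \<forall>\<rho>\<in>P. avoids_pattern \<pi> \<rho>} =
      rev ` {w \<in> permutations_of_multiset S. A w}" (is "?l = ?r")
  proof (intro equalityI subsetI)
    fix \<pi> assume "\<pi> \<in> ?l"
    then show "\<pi> \<in> ?r" using assms[of "rev \<pi>"]
      by (intro image_eqI[of _ _ "rev \<pi>"]) (auto simp: permutations_of_multiset_def)
  qed (auto simp: permutations_of_multiset_def assms[symmetric])
  then show ?thesis by (simp add: av_def card_image)
qed

theorem theorem2p16:
  shows "{[1,1,2], [1,2,3,1]} \<sim>\<^sub>m {[1,2,1], [1,1,3,2]}"
proof -
  have "av S {[1,1,2], [1,2,3,1]} = av S {[1,2,1], [1,1,3,2]}" for S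
  proof -
    have "av S {[1,1,2], [1,2,3,1]} = card (wordsP S)"
      unfolding wordsP_def
      \<comment> \<open>The reverses of 112 and 1231 are 211 and 1321.\<close>
      by (rule av_eq_card_rev) (auto simp: contains_112 contains_1231 avoidsP_def subseq_rev_right simp del: One_nat_def)
    moreover have "av S {[1,2,1], [1,1,3,2]} = card (wordsQ S)"
      unfolding wordsQ_def
      \<comment> \<open>The pattern 121 is its own reverse, and 1132 reverses to 2311.\<close>
      by (rule av_eq_card_rev) (auto simp: contains_121 contains_1132 avoidsQ_def subseq_rev_right simp del: One_nat_def)
    ultimately show ?thesis
      using ex_run_preserving_bij[of S] bij_betw_same_card by metis
  qed
  then show ?thesis by (simp add: m_equivalent_def)
qed

end
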